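(* Let $G$ be a connected graph of order $n\geq 5$ and minimum degree $\delta$. If $$\rho(G) \geq \frac{\delta-1}{2}+\sqrt{2+(n-\delta-1)(n-4) + \frac{(\delta+1)^2}{4}},$$ then $G$ is super-$\kappa$.
   Context: All graphs are finite, simple and undirected. $\rho(G)$ denotes the spectral radius (largest eigenvalue) of the adjacency matrix of $G$. A vertex-cut of a connected graph is a set of vertices whose removal disconnects it; a minimum vertex-cut is one of minimum size. $G$ is super-connected (super-$\kappa$) if every minimum vertex-cut isolates a vertex of minimum degree (i.e., for every minimum vertex-cut $S$, some component of $G-S$ is a single vertex of degree $\delta(G)$). *)

theory Defs
  imports
    "Graph_Theory.Digraph_Component"
    "Jordan_Normal_Form.Spectral_Radius"
begin

text \<open>
  A finite simple undirected graph is a finite symmetric digraph without loops and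
  parallel arcs (locale \<^locale>\<open>graph\<close>): every edge is a pair of opposite arcs, so the
  degree of a vertex is its out-degree.
\<close>

definition min_degree :: "('a, 'b) pre_digraph \<Rightarrow> nat" where
  "min_degree G = Min (out_degree G ` verts G)"


definition adjacency_mat :: "('a, 'b) pre_digraph \<Rightarrow> 'a list \<Rightarrow> real mat" where
  "adjacency_mat G vs = mat (length vs) (length vs)
     (\<lambda>(i, j). if (vs ! i, vs ! j) \<in> arcs_ends G then 1 else 0)"

text \<open>
  The enumeration of the vertices is chosen arbitrarily; \<open>graph_spectral_radius_eq\<close> below
  shows that it is irrelevant. The maximum is over the real eigenvalues, which for this
  symmetric matrix are all the eigenvalues.
\<close>

definition graph_spectral_radius :: "('a, 'b) pre_digraph \<Rightarrow> real" where
  "graph_spectral_radius G =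
     Max (spectrum (adjacency_mat G (SOME vs. distinct vs \<and> set vs = verts G)))"


definition remove_verts :: "('a, 'b) pre_digraph \<Rightarrow> 'a set \<Rightarrow> ('a, 'b) pre_digraph" where
  "remove_verts G S = G \<restriction> (verts G - S)"

text \<open>
  The condition \<open>S \<noteq> verts G\<close> is needed because the library does not count the null graph as
  connected. Hence a complete graph has no vertex cut.
\<close>

definition vertex_cut :: "('a, 'b) pre_digraph \<Rightarrow> 'a set \<Rightarrow> bool" where
  "vertex_cut G S \<longleftrightarrow> S \<subseteq> verts G \<and> S \<noteq> verts G \<and> \<not> connected (remove_verts G S)"

definition minimum_vertex_cut :: "('a, 'b) pre_digraph \<Rightarrow> 'a set \<Rightarrow> bool" where
  "minimum_vertex_cut G S \<longleftrightarrow>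
     vertex_cut G S \<and> (\<forall>T. vertex_cut G T \<longrightarrow> card S \<le> card T)"

text \<open>
  In a symmetric digraph the strongly connected components are the connected components.
  The degree is taken in \<open>G\<close>, not in \<open>G - S\<close>.
\<close>

definition super_connected :: "('a, 'b) pre_digraph \<Rightarrow> bool" where
  "super_connected G \<longleftrightarrow>
     (\<forall>S. minimum_vertex_cut G S \<longrightarrow>
        (\<exists>v. {v} \<in> pre_digraph.sccs_verts (remove_verts G S) \<and> out_degree G v = min_degree G))"


lemma adjacency_mat_carrier [simp]: "adjacency_mat G vs \<in> carrier_mat (length vs) (length vs)"
  by (simp add: adjacency_mat_def)

lemma eigenvalue_adjacency_mat_iff:
  assumes "distinct vs"
  shows "eigenvalue (adjacency_mat G vs) k \<longleftrightarrow>
    (\<exists>f. (\<exists>u\<in>set vs. f u \<noteq> 0) \<and>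
         (\<forall>u\<in>set vs. (\<Sum>w\<in>set vs. (if (u, w) \<in> arcs_ends G then f w else 0)) = k * f u))"
    (is "?L \<longleftrightarrow> (\<exists>f. ?P f)")
proof -
  let ?n = "length vs"
  have row: "(adjacency_mat G vs *\<^sub>v x) $ i =
      (\<Sum>w\<in>set vs. (if (vs ! i, w) \<in> arcs_ends G then f w else 0))"
    if x: "x \<in> carrier_vec ?n" "\<And>j. j < ?n \<Longrightarrow> x $ j = f (vs ! j)" and i: "i < ?n" for x f i
  proof -
    have bij: "bij_betw ((!) vs) {0..<?n} (set vs)"
      using bij_betw_nth[OF assms, of "{0..<?n}" "set vs"] by (auto simp: atLeast0LessThan)
    have "(adjacency_mat G vs *\<^sub>v x) $ i =
        (\<Sum>j\<in>{0..<?n}. if (vs ! i, vs ! j) \<in> arcs_ends G then f (vs ! j) else 0)"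
      using x i by (auto simp: adjacency_mat_def scalar_prod_def intro!: sum.cong)
    also have "\<dots> = (\<Sum>w\<in>set vs. (if (vs ! i, w) \<in> arcs_ends G then f w else 0))"
      by (rule sum.reindex_bij_betw[OF bij])
    finally show ?thesis .
  qed
  show ?thesis
  proof
    assume ?L
    then obtain x where x: "x \<in> carrier_vec ?n" "x \<noteq> 0\<^sub>v ?n" "adjacency_mat G vs *\<^sub>v x = k \<cdot>\<^sub>v x"
      by (auto simp: eigenvalue_def eigenvector_def adjacency_mat_def)
    define f where "f u = x $ (the_inv_into {0..<?n} ((!) vs) u)" for u
    have inj: "inj_on ((!) vs) {0..<?n}"
      using assms by (auto simp: inj_on_def nth_eq_iff_index_eq)
    have f: "f (vs ! j) = x $ j" if "j < ?n" for j
      using the_inv_into_f_f[OF inj, of j] that by (simp add: f_def)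
    have "\<exists>i<?n. x $ i \<noteq> 0" using x(1,2) by (auto intro: eq_vecI)
    then have "\<exists>u\<in>set vs. f u \<noteq> 0" using f by (metis nth_mem)
    moreover have "(\<Sum>w\<in>set vs. (if (u, w) \<in> arcs_ends G then f w else 0)) = k * f u"
      if u: "u \<in> set vs" for u
    proof -
      from u obtain i where i: "i < ?n" "u = vs ! i" by (auto simp: in_set_conv_nth)
      have "(k \<cdot>\<^sub>v x) $ i = k * f u" using i x(1) f by simp
      then show ?thesis using row[of x f i] x f i by simp
    qed
    ultimately show "\<exists>f. ?P f" by blast
  next
    assume "\<exists>f. ?P f"
    then obtain f where f: "?P f" by blast
    define x where "x = vec ?n (\<lambda>i. f (vs ! i))"
    have x: "x \<in> carrier_vec ?n" "\<And>j. j < ?n \<Longrightarrow> x $ j = f (vs ! j)" by (auto simp: x_def)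
    from f obtain i where i: "i < ?n" "f (vs ! i) \<noteq> 0" by (auto simp: in_set_conv_nth)
    have "x \<noteq> 0\<^sub>v ?n" using i x by (metis index_zero_vec(1))
    moreover have "adjacency_mat G vs *\<^sub>v x = k \<cdot>\<^sub>v x"
    proof (rule eq_vecI)
      fix j assume "j < dim_vec (k \<cdot>\<^sub>v x)"
      then have j: "j < ?n" by (simp add: x_def)
      show "(adjacency_mat G vs *\<^sub>v x) $ j = (k \<cdot>\<^sub>v x) $ j"
        using row[OF x j] f j x by simp
    qed (simp add: adjacency_mat_def x_def)
    ultimately show ?L
      using x(1) by (auto simp: eigenvalue_def eigenvector_def adjacency_mat_def)
  qed
qed

lemma graph_spectral_radius_eq:
  assumes "distinct vs" "set vs = verts G"
  shows "graph_spectral_radius G = Max (spectrum (adjacency_mat G vs))"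
proof -
  let ?ws = "SOME ws. distinct ws \<and> set ws = verts G"
  have ws: "distinct ?ws \<and> set ?ws = verts G"
    by (rule someI[of _ vs]) (use assms in simp)
  have "spectrum (adjacency_mat G ?ws) = spectrum (adjacency_mat G vs)"
    unfolding spectrum_def
    using eigenvalue_adjacency_mat_iff[of ?ws G] eigenvalue_adjacency_mat_iff[OF assms(1), of G]
      ws assms(2) by (intro Collect_cong) simp
  then show ?thesis by (simp add: graph_spectral_radius_def)
qed

lemma finite_spectrum_adjacency_mat: "finite (spectrum (adjacency_mat G vs))"
  by (rule card_finite_spectrum(1)[OF adjacency_mat_carrier])

lemma spectrum_adjacency_mat_nonempty:
  assumes sym: "symmetric G" and ne: "vs \<noteq> []"
  shows "spectrum (adjacency_mat G vs) \<noteq> {}"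
proof -
  let ?n = "length vs"
  define A where "A = adjacency_mat G vs"
  define C where "C = map_mat complex_of_real A"
  have A: "A \<in> carrier_mat ?n ?n" and C: "C \<in> carrier_mat ?n ?n"
    by (auto simp: A_def C_def adjacency_mat_def)
  have symC: "C $$ (i, j) = C $$ (j, i)" "cnj (C $$ (i, j)) = C $$ (i, j)"
    if "i < ?n" "j < ?n" for i j
    using that arcs_ends_symmetric[OF sym] by (auto simp: C_def A_def adjacency_mat_def)
  obtain k where k: "k \<in> spectrum C" using spectrum_non_empty[OF C] ne by auto
  then obtain x where x: "x \<in> carrier_vec ?n" "x \<noteq> 0\<^sub>v ?n" "C *\<^sub>v x = k \<cdot>\<^sub>v x"
    using C by (auto simp: spectrum_def eigenvalue_def eigenvector_def)
  define Q where "Q = (\<Sum>i<?n. \<Sum>j<?n. cnj (x $ i) * C $$ (i, j) * x $ j)"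
  define N where "N = (\<Sum>i<?n. (cmod (x $ i))\<^sup>2)"
  have "(\<Sum>j<?n. C $$ (i, j) * x $ j) = k * x $ i" if "i < ?n" for i
  proof -
    have "(C *\<^sub>v x) $ i = (\<Sum>j<?n. C $$ (i, j) * x $ j)"
      using that C x(1) by (auto simp: scalar_prod_def atLeast0LessThan intro!: sum.cong)
    then show ?thesis using that x by simp
  qed
  then have "Q = (\<Sum>i<?n. cnj (x $ i) * (k * x $ i))"
    unfolding Q_def by (simp add: mult.assoc sum_distrib_left[symmetric])
  also have "\<dots> = k * of_real N"
    by (auto simp: N_def sum_distrib_left complex_norm_square mult_ac intro!: sum.cong
             simp del: of_real_power)
  finally have Q: "Q = k * of_real N" .
  have "cnj Q = (\<Sum>i<?n. \<Sum>j<?n. x $ i * C $$ (i, j) * cnj (x $ j))"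
    unfolding Q_def by (auto simp: symC(2) intro!: sum.cong)
  also have "\<dots> = (\<Sum>j<?n. \<Sum>i<?n. x $ i * C $$ (i, j) * cnj (x $ j))"
    by (rule sum.swap)
  also have "\<dots> = Q"
    unfolding Q_def by (intro sum.cong refl) (use symC(1) in \<open>auto simp: mult_ac\<close>)
  finally have "cnj k * of_real N = k * of_real N" using Q by simp
  moreover have "N \<noteq> 0"
  proof
    assume "N = 0"
    then have "\<forall>i<?n. x $ i = 0" by (simp add: N_def sum_nonneg_eq_0_iff)
    then have "x = 0\<^sub>v ?n" using x(1) by (intro eq_vecI) auto
    with x(2) show False by simp
  qed
  ultimately have "cnj k = k" by simp
  then obtain r where r: "k = complex_of_real r" by (metis Reals_cnj_iff Reals_cases)
  have "poly (char_poly C) k = 0" using eigenvalue_root_char_poly[OF C] k by (simp add: spectrum_def)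
  also have "char_poly C = map_poly complex_of_real (char_poly A)"
    unfolding C_def by (rule of_real_hom.char_poly_hom[OF A])
  finally have "poly (char_poly A) r = 0" unfolding r by (simp add: of_real_hom.poly_map_poly)
  then have "r \<in> spectrum A" using eigenvalue_root_char_poly[OF A] by (simp add: spectrum_def)
  then show ?thesis by (auto simp: A_def)
qed

end

theory Submission
  imports Defs
begin

text \<open>
  Write \<open>D = n - 1 - \<delta>\<close>, \<open>m\<close> for the number of edges and \<open>N\<close> for the number of ordered
  pairs of distinct non-adjacent vertices. Applying \<open>A\<^sup>2 - (\<delta> - 1) A\<close> to \<open>y = |x|\<close>, where \<open>x\<close>
  is an eigenvector for \<open>\<rho>\<close>, and adding up the entries yields the bound
  \<open>\<rho>\<^sup>2 - (\<delta> - 1) \<rho> \<le> 2m - (n - 1) \<delta>\<close> of Hong, with equality only if every vertex that has a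
  non-neighbour has degree \<open>\<delta>\<close>. So the hypothesis on \<open>\<rho>\<close> gives \<open>N \<le> 4D - 2\<close>. A minimum cut that
  isolates no vertex of degree \<open>\<delta>\<close> separates two parts of at least two vertices each, and
  counting the non-adjacent pairs that this forces gives \<open>N \<ge> 4D - 2\<close>, strictly if all vertices
  of the parts have degree \<open>\<delta>\<close>. This excludes the equality case of the spectral bound.
\<close>

unbundle no funcset_syntax \<comment> \<open>its arrow clashes with the one for adjacency\<close>

section \<open>Isolated vertices and connectivity\<close>

lemma (in wf_digraph) isolated_in_sccs_verts:
  assumes "x \<in> verts G" "\<And>w. \<not> x \<rightarrow> w"
  shows "{x} \<in> sccs_verts"
proof -
  have "v = x" if "x \<rightarrow>\<^sup>* v" for v
    using that assms(2) by (cases rule: converse_reachable_cases) auto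
  then show ?thesis
    using assms(1) by (auto simp: in_sccs_verts_conv_reachable)
qed

text \<open>In a symmetric digraph connectedness is strong connectedness, so some \<open>u\<close>
  fails to reach some \<open>v\<close>. The set reachable from \<open>u\<close> is closed under arcs
  and serves as one side.\<close>

lemma (in sym_digraph) not_connected_imp_separation:
  assumes "\<not> connected G" "verts G \<noteq> {}"
  shows "\<exists>A B. A \<union> B = verts G \<and> A \<inter> B = {} \<and> A \<noteq> {} \<and> B \<noteq> {} \<and>
    (\<forall>a\<in>A. \<forall>b\<in>B. \<not> a \<rightarrow> b)"
proof -
  have "\<not> strongly_connected G"
    using assms by (auto simp: connected_def strongly_connected_def reachable_mk_symmetric_eq[OF sym_arcs])
  then obtain u v where uv: "u \<in> verts G" "v \<in> verts G" "\<not> u \<rightarrow>\<^sup>* v"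
    using assms(2) by (auto simp: strongly_connected_def)
  define A where "A = {w. u \<rightarrow>\<^sup>* w}"
  have "A \<union> (verts G - A) = verts G" by (auto simp: A_def reachable_in_verts)
  moreover have "A \<noteq> {}" "verts G - A \<noteq> {}" using uv by (auto simp: A_def)
  moreover have "\<forall>a\<in>A. \<forall>b\<in>verts G - A. \<not> a \<rightarrow> b"
    using reachable_adj_trans by (auto simp: A_def)
  ultimately show ?thesis by (intro exI[of _ A] exI[of _ "verts G - A"]) simp
qed

lemma arcs_ends_induce_subgraph:
  "arcs_ends (G \<restriction> U) = arcs_ends G \<inter> U \<times> U"
  by (auto simp: arcs_ends_conv)

lemma (in sym_digraph) sym_digraph_induce_subgraph: "sym_digraph (G \<restriction> U)"
proof -
  have "symmetric (G \<restriction> U)"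
    using graph_symmetric by (auto simp: symmetric_def sym_def arcs_ends_induce_subgraph)
  then show ?thesis
    by (intro wf_digraph.sym_digraphI wellformed_induce_subgraph)
qed

section \<open>Degrees and non-neighbours\<close>

context graph
begin

lemma finite_neighbours [simp]: "finite {w. u \<rightarrow> w}"
  by (rule finite_subset[OF _ finite_verts]) (auto dest: adj_in_verts)

lemma out_degree_eq_card: "out_degree G u = card {w. u \<rightarrow> w}"
proof -
  have "{w. u \<rightarrow> w} = head G ` out_arcs G u"
    by (auto simp: arcs_ends_conv)
  moreover have "inj_on (head G) (out_arcs G u)"
    by (auto simp: inj_on_def arc_to_ends_def intro!: no_multi_arcs)
  ultimately show ?thesis by (simp add: out_degree_def card_image)
qed

lemma out_degree_eq_sum: "real (out_degree G u) = (\<Sum>w\<in>verts G. of_bool (u \<rightarrow> w))"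
proof -
  have "{w \<in> verts G. u \<rightarrow> w} = {w. u \<rightarrow> w}" by (auto dest: adj_in_verts)
  then show ?thesis by (simp add: out_degree_eq_card Int_def flip: of_nat_sum)
qed

lemma card_nonadjacent:
  assumes "u \<in> verts G"
  shows "card {w \<in> verts G. w \<noteq> u \<and> \<not> u \<rightarrow> w} + out_degree G u + 1 = card (verts G)"
proof -
  have eq: "verts G = insert u ({w \<in> verts G. w \<noteq> u \<and> \<not> u \<rightarrow> w} \<union> {w. u \<rightarrow> w})"
    using assms by (auto dest: adj_in_verts)
  have "card (insert u ({w \<in> verts G. w \<noteq> u \<and> \<not> u \<rightarrow> w} \<union> {w. u \<rightarrow> w})) =
    Suc (card ({w \<in> verts G. w \<noteq> u \<and> \<not> u \<rightarrow> w} \<union> {w. u \<rightarrow> w}))"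
    by (rule card_insert_disjoint) (auto dest: adj_not_same)
  also have "card ({w \<in> verts G. w \<noteq> u \<and> \<not> u \<rightarrow> w} \<union> {w. u \<rightarrow> w}) =
      card {w \<in> verts G. w \<noteq> u \<and> \<not> u \<rightarrow> w} + card {w. u \<rightarrow> w}"
    by (rule card_Un_disjoint) auto
  finally show ?thesis using eq by (simp add: out_degree_eq_card)
qed

section \<open>The spectral bound\<close>

lemma spectral_radius_eigenfunction:
  assumes "verts G \<noteq> {}"
  obtains f where "\<exists>u\<in>verts G. f u \<noteq> 0"
    "\<And>u. u \<in> verts G \<Longrightarrow>
       (\<Sum>w\<in>verts G. of_bool (u \<rightarrow> w) * f w) = graph_spectral_radius G * f u"
proof -
  obtain vs where vs: "set vs = verts G" "distinct vs"
    using finite_distinct_list[OF finite_verts] by blast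
  have "vs \<noteq> []" using vs(1) assms by auto
  \<comment> \<open>\<open>Max\<close> is attained because the spectrum is finite and, by symmetry
    of the matrix, has a real element.\<close>
  then have "graph_spectral_radius G \<in> spectrum (adjacency_mat G vs)"
    unfolding graph_spectral_radius_eq[OF vs(2,1)]
    by (intro Max_in finite_spectrum_adjacency_mat spectrum_adjacency_mat_nonempty sym_arcs)
  then have "eigenvalue (adjacency_mat G vs) (graph_spectral_radius G)"
    by (simp add: spectrum_def)
  then obtain f where f: "\<exists>u\<in>verts G. f u \<noteq> 0"
    "\<And>u. u \<in> verts G \<Longrightarrow>
       (\<Sum>w\<in>verts G. if u \<rightarrow> w then f w else 0) = graph_spectral_radius G * f u"
    unfolding eigenvalue_adjacency_mat_iff[OF vs(2)] vs(1) by blast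
  have "of_bool (u \<rightarrow> w) * f w = (if u \<rightarrow> w then f w else 0)" for u w by simp
  with f show ?thesis by (intro that[of f]) simp_all
qed

text \<open>
  The factorization \<open>A\<^sup>2 - (\<delta> - 1) A - (k\<^sup>2 - (\<delta> - 1) k) = (A + k - \<delta> + 1) (A - k)\<close> is what
  makes a subeigenvector \<open>y\<close>, for which \<open>z \<ge> 0\<close>, good enough: no Perron--Frobenius theory is
  needed. Row \<open>u\<close> of \<open>A\<^sup>2 - (\<delta> - 1) A\<close> sums to \<open>2m - (n - 1) \<delta> - g u\<close>.
\<close>

lemma eigen_defect_identity:
  fixes y :: "'a \<Rightarrow> real" and k \<delta> :: real
  defines "z \<equiv> \<lambda>u. (\<Sum>w\<in>verts G. of_bool (u \<rightarrow> w) * y w) - k * y u"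
    and "g \<equiv> \<lambda>u. \<Sum>w\<in>verts G. of_bool (w \<noteq> u \<and> \<not> u \<rightarrow> w) * (real (out_degree G w) - \<delta>)"
  shows "((\<Sum>u\<in>verts G. real (out_degree G u)) - (real (card (verts G)) - 1) * \<delta>
            - (k\<^sup>2 - (\<delta> - 1) * k)) * (\<Sum>u\<in>verts G. y u) =
    (\<Sum>u\<in>verts G. y u * g u) + (\<Sum>u\<in>verts G. (real (out_degree G u) + k - \<delta> + 1) * z u)"
proof -
  let ?V = "verts G"
  let ?d = "\<lambda>u. real (out_degree G u)"
  define M where "M = (\<Sum>u\<in>?V. ?d u)"
  define Y where "Y = (\<Sum>u\<in>?V. y u)"
  define Ay where "Ay u = (\<Sum>w\<in>?V. of_bool (u \<rightarrow> w) * y w)" for u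
  define R where "R u = (\<Sum>w\<in>?V. of_bool (u \<rightarrow> w) * ?d w)" for u
  have sym: "u \<rightarrow> w \<longleftrightarrow> w \<rightarrow> u" for u w using graph_symmetric by blast
  \<comment> \<open>The adjacency operator is self-adjoint; used with \<open>h\<close> constantly 1
    and with \<open>h\<close> the degree.\<close>
  have swap: "(\<Sum>u\<in>?V. h u * Ay u) = (\<Sum>u\<in>?V. (\<Sum>w\<in>?V. of_bool (u \<rightarrow> w) * h w) * y u)"
    for h :: "'a \<Rightarrow> real"
  proof -
    have "(\<Sum>u\<in>?V. h u * Ay u) = (\<Sum>u\<in>?V. \<Sum>w\<in>?V. of_bool (u \<rightarrow> w) * h u * y w)"
      unfolding Ay_def sum_distrib_left by (simp only: mult_ac)
    also have "\<dots> = (\<Sum>w\<in>?V. \<Sum>u\<in>?V. of_bool (u \<rightarrow> w) * h u * y w)"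
      by (rule sum.swap)
    also have "\<dots> = (\<Sum>w\<in>?V. \<Sum>u\<in>?V. of_bool (w \<rightarrow> u) * h u * y w)"
      by (intro sum.cong refl) (simp add: sym)
    finally show ?thesis by (simp only: sum_distrib_right)
  qed
  have g: "g u = M - ?d u - R u - (real (card ?V) - 1 - ?d u) * \<delta>" if u: "u \<in> ?V" for u
  proof -
    \<comment> \<open>Without loops, the indicators of equality, adjacency and non-adjacency to
      \<open>u\<close> add up to 1.\<close>
    have *: "of_bool (w \<noteq> u \<and> \<not> u \<rightarrow> w) * (?d w - \<delta>) =
        ?d w - of_bool (w = u) * ?d w - of_bool (u \<rightarrow> w) * ?d w
        - \<delta> * (1 - of_bool (w = u) - of_bool (u \<rightarrow> w))" for w
      using adj_not_same by (auto simp: of_bool_def algebra_simps)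
    have "(\<Sum>w\<in>?V. of_bool (w = u) * ?d w) = ?d u" "(\<Sum>w\<in>?V. of_bool (w = u)) = (1::real)"
      using u by (simp_all add: of_bool_def if_distrib[of "\<lambda>x. x * _"] cong: if_cong)
    then show ?thesis
      unfolding g_def *
      by (simp add: sum_subtractf M_def R_def out_degree_eq_sum[of u] flip: sum_distrib_left)
  qed
  have Ay1: "(\<Sum>u\<in>?V. Ay u) = (\<Sum>u\<in>?V. ?d u * y u)"
    using swap[of "\<lambda>_. 1"] by (simp add: out_degree_eq_sum)
  have Ayd: "(\<Sum>u\<in>?V. ?d u * Ay u) = (\<Sum>u\<in>?V. R u * y u)"
    using swap[of ?d] by (simp add: R_def)
  \<comment> \<open>\<open>P\<close> and \<open>Q\<close> are the entry sums of \<open>A y\<close>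
    and of \<open>A (A y)\<close>, for \<open>A\<close> the adjacency matrix. They cancel when
    \<open>1\<close> and \<open>2\<close> are added, leaving multiples of \<open>Y\<close>.\<close>
  define P where "P = (\<Sum>u\<in>?V. ?d u * y u)"
  define Q where "Q = (\<Sum>u\<in>?V. R u * y u)"
  have 1: "(\<Sum>u\<in>?V. y u * g u) = M * Y - P - Q - ((real (card ?V) - 1) * Y - P) * \<delta>"
  proof -
    have "(\<Sum>u\<in>?V. y u * g u) =
      (\<Sum>u\<in>?V. M * y u - ?d u * y u - R u * y u - ((real (card ?V) - 1) * y u - ?d u * y u) * \<delta>)"
      by (intro sum.cong refl) (simp add: g algebra_simps)
    then show ?thesis
      by (simp add: sum_subtractf Y_def P_def Q_def flip: sum_distrib_left sum_distrib_right)
  qed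
  have 2: "(\<Sum>u\<in>?V. (?d u + k - \<delta> + 1) * z u) = Q - k * P + (k - \<delta> + 1) * (P - k * Y)"
  proof -
    have "(\<Sum>u\<in>?V. (?d u + k - \<delta> + 1) * z u) =
      (\<Sum>u\<in>?V. ?d u * Ay u - k * (?d u * y u) + (k - \<delta> + 1) * (Ay u - k * y u))"
      unfolding z_def Ay_def[symmetric] by (intro sum.cong refl) (simp add: algebra_simps)
    then show ?thesis
      by (simp add: sum.distrib sum_subtractf Y_def P_def Q_def Ayd Ay1 flip: sum_distrib_left)
  qed
  show ?thesis
    unfolding 1 2 M_def[symmetric] Y_def[symmetric]
    by (simp add: algebra_simps power2_eq_square)
qed

text \<open>For \<open>y = |f|\<close> the triangle inequality gives \<open>z\<close> \<ge> 0, so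
  every term on the right of \<open>eigen_defect_identity\<close> is non-negative; dividing by
  \<open>Y > 0\<close> gives the bound. In the equality case all terms vanish: \<open>z = 0\<close>
  and connectivity make \<open>y\<close> positive everywhere, hence \<open>g = 0\<close>.\<close>

lemma eigenvalue_bound:
  fixes f :: "'a \<Rightarrow> real" and k :: real and \<delta> :: nat
  assumes conn: "connected G"
    and f: "\<exists>u\<in>verts G. f u \<noteq> 0"
    and eig: "\<And>u. u \<in> verts G \<Longrightarrow> (\<Sum>w\<in>verts G. of_bool (u \<rightarrow> w) * f w) = k * f u"
    and k: "k \<ge> 0"
    and deg: "\<And>u. u \<in> verts G \<Longrightarrow> \<delta> \<le> out_degree G u"
  defines "K \<equiv> (\<Sum>u\<in>verts G. real (out_degree G u)) - (real (card (verts G)) - 1) * \<delta>"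
  shows "k\<^sup>2 - (real \<delta> - 1) * k \<le> K"
    and "k\<^sup>2 - (real \<delta> - 1) * k = K \<Longrightarrow> u \<in> verts G \<Longrightarrow> w \<in> verts G \<Longrightarrow> w \<noteq> u \<Longrightarrow> \<not> u \<rightarrow> w
      \<Longrightarrow> out_degree G w = \<delta>"
proof -
  let ?V = "verts G"
  let ?d = "\<lambda>u. real (out_degree G u)"
  define y where "y u = \<bar>f u\<bar>" for u
  define z where "z u = (\<Sum>w\<in>?V. of_bool (u \<rightarrow> w) * y w) - k * y u" for u
  define g where "g u = (\<Sum>w\<in>?V. of_bool (w \<noteq> u \<and> \<not> u \<rightarrow> w) * (?d w - \<delta>))" for u
  define Y where "Y = (\<Sum>u\<in>?V. y u)"
  have y: "y u \<ge> 0" for u by (simp add: y_def)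
  have z: "z u \<ge> 0" if "u \<in> ?V" for u
  proof -
    have "k * y u = \<bar>\<Sum>w\<in>?V. of_bool (u \<rightarrow> w) * f w\<bar>"
      using eig[OF that] k by (simp add: y_def abs_mult)
    also have "\<dots> \<le> (\<Sum>w\<in>?V. \<bar>of_bool (u \<rightarrow> w) * f w\<bar>)" by (rule sum_abs)
    also have "\<dots> = (\<Sum>w\<in>?V. of_bool (u \<rightarrow> w) * y w)" by (simp add: y_def abs_mult)
    finally show ?thesis by (simp add: z_def)
  qed
  have g: "g u \<ge> 0" for u
    unfolding g_def by (intro sum_nonneg mult_nonneg_nonneg) (use deg in auto)
  \<comment> \<open>The weight is at least 1, even for \<open>k = 0\<close>; strictness later forces
    \<open>z = 0\<close>.\<close>
  have c: "?d u + k - \<delta> + 1 > 0" if "u \<in> ?V" for u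
    using deg[OF that] k by simp
  have id: "(K - (k\<^sup>2 - (real \<delta> - 1) * k)) * Y =
      (\<Sum>u\<in>?V. y u * g u) + (\<Sum>u\<in>?V. (?d u + k - \<delta> + 1) * z u)"
    unfolding K_def Y_def g_def z_def by (rule eigen_defect_identity)
  have yg: "(\<Sum>u\<in>?V. y u * g u) \<ge> 0"
    by (intro sum_nonneg mult_nonneg_nonneg y g)
  have cz_nonneg: "(?d u + k - \<delta> + 1) * z u \<ge> 0" if "u \<in> ?V" for u
    using c[OF that] z[OF that] by simp
  then have cz: "(\<Sum>u\<in>?V. (?d u + k - \<delta> + 1) * z u) \<ge> 0"
    by (rule sum_nonneg)
  from f obtain u0 where u0: "u0 \<in> ?V" "y u0 > 0" by (auto simp: y_def)
  then have Y: "Y > 0" unfolding Y_def by (intro sum_pos2[of _ u0] y) simp_all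
  have "(K - (k\<^sup>2 - (real \<delta> - 1) * k)) * Y \<ge> 0" using id yg cz by linarith
  then show "k\<^sup>2 - (real \<delta> - 1) * k \<le> K" using Y by (simp add: zero_le_mult_iff)
  assume eq: "k\<^sup>2 - (real \<delta> - 1) * k = K" and u: "u \<in> ?V" and w: "w \<in> ?V" "w \<noteq> u" "\<not> u \<rightarrow> w"
  have "(\<Sum>u\<in>?V. y u * g u) = 0" and "(\<Sum>u\<in>?V. (?d u + k - \<delta> + 1) * z u) = 0"
    using id eq yg cz by auto
  then have yg0: "y u * g u = 0" and cz0: "(?d u + k - \<delta> + 1) * z u = 0" if "u \<in> ?V" for u
    using that y g cz_nonneg by (simp_all add: sum_nonneg_eq_0_iff)
  have z0: "z u = 0" if "u \<in> ?V" for u using c[OF that] cz0[OF that] by simp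
  \<comment> \<open>As \<open>z\<close> vanishes, a zero of \<open>y\<close> forces zeros at all its
    neighbours. Positivity thus spreads along arcs, from \<open>u0\<close> to every vertex.\<close>
  have step: "y x > 0" if "y v > 0" "x \<rightarrow> v" for x v
  proof (rule ccontr)
    assume "\<not> y x > 0"
    then have "y x = 0" using y[of x] by simp
    then have "(\<Sum>w\<in>?V. of_bool (x \<rightarrow> w) * y w) = 0"
      using z0[of x] adj_in_verts(1)[OF that(2)] by (simp add: z_def)
    then have "of_bool (x \<rightarrow> v) * y v = 0"
      using y adj_in_verts(2)[OF that(2)] by (simp add: sum_nonneg_eq_0_iff)
    then show False using that by simp
  qed
  have "u \<rightarrow>\<^sup>* u0"
    using symmetric_connected_imp_strongly_connected[OF sym_arcs conn] u u0
    by (simp add: strongly_connected_def)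
  then have "y u > 0" using u0(2) by induct (use step in auto)
  then have "g u = 0" using yg0[OF u] by simp
  then have "of_bool (w \<noteq> u \<and> \<not> u \<rightarrow> w) * (?d w - \<delta>) = 0"
    using w(1) deg unfolding g_def by (subst (asm) sum_nonneg_eq_0_iff) auto
  then show "out_degree G w = \<delta>" using w by simp
qed

section \<open>Minimum cuts and non-adjacent pairs\<close>

lemma min_degree_le: "u \<in> verts G \<Longrightarrow> min_degree G \<le> out_degree G u"
  by (simp add: min_degree_def)

lemma obtains_min_degree:
  assumes "verts G \<noteq> {}"
  obtains v where "v \<in> verts G" "out_degree G v = min_degree G"
proof -
  have "min_degree G \<in> out_degree G ` verts G"
    unfolding min_degree_def by (rule Min_in) (use assms in auto)
  then show ?thesis using that by auto
qed

text \<open>The neighbourhood of a vertex \<open>v\<close> of minimum degree is itself a cut,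
  provided that \<open>v\<close> has a non-neighbour to be separated from.\<close>

lemma minimum_vertex_cut_card_le:
  assumes cut: "minimum_vertex_cut G S"
    and ab: "a \<in> verts G" "b \<in> verts G" "a \<noteq> b" "\<not> a \<rightarrow> b"
  shows "card S \<le> min_degree G"
proof -
  obtain v where v: "v \<in> verts G" "out_degree G v = min_degree G"
    using obtains_min_degree ab by blast
  let ?T = "{w. v \<rightarrow> w}"
  \<comment> \<open>Minimum degree means most non-neighbours, so \<open>v\<close> has at least as
    many as \<open>a\<close>, which has \<open>b\<close>.\<close>
  have "card {w \<in> verts G. w \<noteq> a \<and> \<not> a \<rightarrow> w} > 0"
    using ab by (auto simp: card_gt_0_iff)
  then have "card {w \<in> verts G. w \<noteq> v \<and> \<not> v \<rightarrow> w} > 0"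
    using card_nonadjacent[OF ab(1)] card_nonadjacent[OF v(1)] min_degree_le[OF ab(1)] v(2)
    by linarith
  then obtain w where w: "w \<in> verts G" "w \<noteq> v" "\<not> v \<rightarrow> w"
    by (auto simp: card_gt_0_iff)
  let ?H = "remove_verts G ?T"
  interpret H: sym_digraph ?H
    unfolding remove_verts_def by (rule sym_digraph_induce_subgraph)
  have vH: "v \<in> verts ?H" "w \<in> verts ?H"
    using v w adj_not_same by (auto simp: remove_verts_def)
  have "\<not> connected ?H"
  proof
    assume "connected ?H"
    then have "v \<rightarrow>\<^sup>*\<^bsub>?H\<^esub> w"
      using H.symmetric_connected_imp_strongly_connected[OF H.sym_arcs] vH
      by (simp add: strongly_connected_def)
    then show False
      using w(2) by (cases rule: H.converse_reachable_cases)
        (auto simp: remove_verts_def arcs_ends_induce_subgraph)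
  qed
  then have "vertex_cut G ?T"
    using w adj_in_verts by (auto simp: vertex_cut_def)
  then show ?thesis
    using cut v(2) by (auto simp: minimum_vertex_cut_def out_degree_eq_card)
qed

definition nonadjacent_pairs :: "('a \<times> 'a) set" where
  "nonadjacent_pairs = (SIGMA u:verts G. {w \<in> verts G. w \<noteq> u \<and> \<not> u \<rightarrow> w})"

lemma finite_nonadjacent_pairs [simp]: "finite nonadjacent_pairs"
  by (auto simp: nonadjacent_pairs_def)

text \<open>Translates the degree sum of the spectral bound into the count that a cut
  controls.\<close>

lemma real_card_nonadjacent_pairs:
  "real (card nonadjacent_pairs) =
    real (card (verts G)) * (real (card (verts G)) - 1) - (\<Sum>u\<in>verts G. real (out_degree G u))"
proof -
  have "real (card nonadjacent_pairs) =
      (\<Sum>u\<in>verts G. real (card {w \<in> verts G. w \<noteq> u \<and> \<not> u \<rightarrow> w}))"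
    unfolding nonadjacent_pairs_def by simp
  also have "\<dots> = (\<Sum>u\<in>verts G. real (card (verts G)) - 1 - real (out_degree G u))"
  proof (intro sum.cong refl)
    fix u assume "u \<in> verts G"
    from card_nonadjacent[OF this]
    show "real (card {w \<in> verts G. w \<noteq> u \<and> \<not> u \<rightarrow> w}) =
        real (card (verts G)) - 1 - real (out_degree G u)"
      by linarith
  qed
  finally show ?thesis by (simp add: sum_subtractf)
qed

end

section \<open>Counting non-adjacent pairs across a cut\<close>

locale separated_graph = graph +
  fixes A B S :: "'a set"
  assumes cover: "verts G = A \<union> B \<union> S"
    and disjoint: "A \<inter> B = {}" "A \<inter> S = {}" "B \<inter> S = {}"
    and no_arc: "a \<in> A \<Longrightarrow> b \<in> B \<Longrightarrow> \<not> a \<rightarrow> b"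
    and two_le: "2 \<le> card A" "2 \<le> card B"
    and card_S_le: "card S \<le> min_degree G"
begin

lemma finites [simp]: "finite A" "finite B" "finite S"
  using finite_verts by (auto simp: cover)

lemma card_verts: "card (verts G) = card A + card B + card S"
proof -
  have "card (A \<union> B \<union> S) = card (A \<union> B) + card S"
    using disjoint by (intro card_Un_disjoint) auto
  then show ?thesis using disjoint by (simp add: cover card_Un_disjoint)
qed

lemma no_arc': "b \<in> B \<Longrightarrow> a \<in> A \<Longrightarrow> \<not> b \<rightarrow> a"
  using no_arc graph_symmetric by blast

text \<open>A vertex of a part has all its neighbours in that part or in \<open>S\<close>, and is
  not its own neighbour.\<close>

lemma min_degree_less_parts:
  "min_degree G < card A + card S" "min_degree G < card B + card S"
proof -
  have *: "min_degree G < card X + card S"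
    if X: "X = A \<or> X = B" for X
  proof -
    obtain x where x: "x \<in> X" using X two_le by fastforce
    have "{w. x \<rightarrow> w} \<subseteq> (X - {x}) \<union> S"
    proof
      fix w assume "w \<in> {w. x \<rightarrow> w}"
      then have "x \<rightarrow> w" by simp
      moreover from this have "w \<in> A \<union> B \<union> S" "w \<noteq> x"
        using adj_in_verts(2) cover adj_not_same by auto
      ultimately show "w \<in> (X - {x}) \<union> S"
        using X x no_arc no_arc' by auto
    qed
    then have "out_degree G x \<le> card ((X - {x}) \<union> S)"
      unfolding out_degree_eq_card using X by (intro card_mono) auto
    also have "\<dots> \<le> card (X - {x}) + card S" by (rule card_Un_le)
    also have "\<dots> < card X + card S" using X x card_Diff1_less[of X x] by auto
    finally show ?thesis using min_degree_le[of x] x X cover by auto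
  qed
  show "min_degree G < card A + card S" "min_degree G < card B + card S"
    using * by auto
qed

text \<open>
  With \<open>t = \<delta> - |S|\<close>, the parts have at least \<open>t + 1\<close> vertices. Parametrizing by the excess avoids
  truncated subtraction in the counts below.
\<close>

lemma parametrize:
  obtains t D p q where "min_degree G = card S + t" "card (verts G) = min_degree G + D + 1"
    "card A = t + 1 + p" "card B = t + 1 + q" "D = p + q + t + 1" "t = 0 \<Longrightarrow> p \<ge> 1 \<and> q \<ge> 1"
proof -
  obtain t where t: "min_degree G = card S + t" using card_S_le le_Suc_ex by blast
  have "t + 1 \<le> card A" "t + 1 \<le> card B" using min_degree_less_parts t by linarith+
  then obtain p q where pq: "card A = t + 1 + p" "card B = t + 1 + q"
    using le_Suc_ex by meson
  \<comment> \<open>Here \<open>D\<close> is |A| + |B| + |S| - 1 - \<delta> with \<delta> = |S| + t.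
    For \<open>t = 0\<close>, the two vertices in each part give \<open>p\<close>, \<open>q\<close>
    \<ge> 1.\<close>
  show ?thesis
    by (rule that[of t "p + q + t + 1" p q]) (use t pq card_verts two_le in linarith)+
qed

lemma parts_subset_nonadjacent_pairs: "A \<times> B \<union> B \<times> A \<subseteq> nonadjacent_pairs"
  using no_arc no_arc' disjoint cover by (auto simp: nonadjacent_pairs_def)

lemma card_parts_pairs: "card (A \<times> B \<union> B \<times> A) = 2 * (card A * card B)"
  using disjoint by (subst card_Un_disjoint) (auto simp: card_cartesian_product)

text \<open>
  A vertex of minimum degree has \<open>|A| + |B| - 1\<close> non-neighbours, more than the cut alone
  accounts for.
\<close>

lemma card_nonadjacent_pairs_ge:
  assumes "card S = min_degree G"
  shows "2 * (card A * card B) + 2 \<le> card nonadjacent_pairs"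
proof -
  let ?P = "A \<times> B \<union> B \<times> A"
  have "verts G \<noteq> {}" using two_le cover by auto
  then obtain v where v: "v \<in> verts G" "out_degree G v = min_degree G"
    by (rule obtains_min_degree)
  have "nonadjacent_pairs \<noteq> ?P"
  proof
    assume eq: "nonadjacent_pairs = ?P"
    have "{w \<in> verts G. w \<noteq> v \<and> \<not> v \<rightarrow> w} = nonadjacent_pairs `` {v}"
      using v(1) by (auto simp: nonadjacent_pairs_def)
    \<comment> \<open>The three cases are \<open>v\<close> in \<open>B\<close>, in \<open>A\<close>
      and in \<open>S\<close>.\<close>
    also have "\<dots> \<in> {A, B, {}}"
      unfolding eq using v(1) cover disjoint by auto
    finally have "card {w \<in> verts G. w \<noteq> v \<and> \<not> v \<rightarrow> w} \<in> card ` {A, B, {}}"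
      by (rule imageI)
    \<comment> \<open>Since both parts have at least two vertices, |A| + |B| - 1 exceeds |A|, |B|
      and 0.\<close>
    moreover have "card {w \<in> verts G. w \<noteq> v \<and> \<not> v \<rightarrow> w} + 1 = card A + card B"
      using card_nonadjacent[OF v(1)] v(2) assms card_verts by linarith
    ultimately show False using two_le by (simp only: image_insert image_empty insert_iff empty_iff card.empty) linarith
  qed
  then obtain x y where xy: "(x, y) \<in> nonadjacent_pairs" "(x, y) \<notin> ?P"
    using parts_subset_nonadjacent_pairs by auto
  have yx: "(y, x) \<in> nonadjacent_pairs"
    using xy(1) graph_symmetric by (auto simp: nonadjacent_pairs_def)
  have "x \<noteq> y" using xy(1) by (auto simp: nonadjacent_pairs_def)
  \<comment> \<open>\<open>?P\<close> is symmetric, so both orders of the pair are new.\<close>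
  then have "card (insert (x, y) (insert (y, x) ?P)) = card ?P + 2"
    using xy(2) by auto
  moreover have "card (insert (x, y) (insert (y, x) ?P)) \<le> card nonadjacent_pairs"
    using xy yx parts_subset_nonadjacent_pairs by (intro card_mono) auto
  ultimately show ?thesis by (simp only: card_parts_pairs)
qed

text \<open>The identity |A| |B| = (t + 1) D + p q settles \<open>t\<close> \<ge> 1 by the cut pairs
  alone. For \<open>t = 0\<close>, (p - 1)(q - 1) \<ge> 0 gives p q \<ge> D - 2, hence 4D - 4 cut
  pairs, and the two extra pairs of \<open>card_nonadjacent_pairs_ge\<close> complete the
  bound.\<close>

lemma card_nonadjacent_pairs_lower_bound:
  assumes D: "card (verts G) = min_degree G + D + 1"
  shows "4 * D \<le> card nonadjacent_pairs + 2"
proof -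
  obtain t p q where *: "min_degree G = card S + t" "card A = t + 1 + p" "card B = t + 1 + q"
    "D = p + q + t + 1" "t = 0 \<Longrightarrow> p \<ge> 1 \<and> q \<ge> 1"
    using parametrize D by (metis add_left_cancel add_right_cancel)
  have pq: "card A * card B = (t + 1) * D + p * q"
    unfolding * by (simp add: algebra_simps)
  show ?thesis
  proof (cases "t = 0")
    case True
    then obtain p' q' where pq': "p = p' + 1" "q = q' + 1"
      using *(5) by (metis add.commute le_Suc_ex)
    have "D \<le> p * q + 2" unfolding *(4) pq' True by (simp add: algebra_simps)
    then have "2 * D \<le> card A * card B + 2" using pq True by simp
    with card_nonadjacent_pairs_ge *(1) True show ?thesis by simp
  next
    case False
    then have "2 * D \<le> (t + 1) * D" by (intro mult_right_mono) auto
    then have "2 * D \<le> card A * card B" unfolding pq by (rule trans_le_add1)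
    moreover have "2 * (card A * card B) \<le> card nonadjacent_pairs"
      unfolding card_parts_pairs[symmetric]
      by (intro card_mono parts_subset_nonadjacent_pairs finite_nonadjacent_pairs)
    ultimately show ?thesis by simp
  qed
qed

text \<open>Each vertex of the parts now has exactly \<open>D\<close> non-neighbours, so there are
  at least (|A| + |B|) D = (D + 1 + t) D pairs.\<close>

lemma card_nonadjacent_pairs_gt:
  assumes D: "card (verts G) = min_degree G + D + 1"
    and deg: "\<And>x. x \<in> A \<union> B \<Longrightarrow> out_degree G x = min_degree G"
  shows "4 * D < card nonadjacent_pairs + 2"
proof -
  obtain t p q where *: "min_degree G = card S + t" "card A = t + 1 + p" "card B = t + 1 + q"
    "D = p + q + t + 1" "t = 0 \<Longrightarrow> p \<ge> 1 \<and> q \<ge> 1"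
    using parametrize D by (metis add_left_cancel add_right_cancel)
  have "card {w \<in> verts G. w \<noteq> x \<and> \<not> x \<rightarrow> w} = D" if "x \<in> A \<union> B" for x
    using card_nonadjacent[of x] deg[OF that] D that cover by auto
  then have "(\<Sum>x\<in>A \<union> B. card {w \<in> verts G. w \<noteq> x \<and> \<not> x \<rightarrow> w}) = card (A \<union> B) * D"
    by simp
  then have "(card A + card B) * D = (\<Sum>x\<in>A \<union> B. card {w \<in> verts G. w \<noteq> x \<and> \<not> x \<rightarrow> w})"
    using disjoint by (simp add: card_Un_disjoint)
  also have "\<dots> \<le> (\<Sum>x\<in>verts G. card {w \<in> verts G. w \<noteq> x \<and> \<not> x \<rightarrow> w})"
    by (intro sum_mono2) (auto simp: cover)
  also have "\<dots> = card nonadjacent_pairs"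
    by (simp add: nonadjacent_pairs_def)
  finally have "(card A + card B) * D \<le> card nonadjacent_pairs" .
  moreover have "4 * D < (card A + card B) * D + 2"
  proof -
    have "card A + card B = D + 1 + t" using * by simp
    moreover have "D \<ge> 2" "t = 0 \<Longrightarrow> D \<ge> 3" using *(4,5) by linarith+
    \<comment> \<open>Shifting by 2 makes the excess a polynomial with non-negative coefficients
      that vanishes only for \<open>D' = t = 0\<close>, the excluded case.\<close>
    then obtain D' where D': "D = D' + 2" "D' \<ge> 1 \<or> t \<ge> 1"
      by (cases "t = 0") (auto dest!: le_Suc_ex)
    ultimately have "(card A + card B) * D + 2 = 4 * D + (D' * D' + D' + t * D' + 2 * t)"
      by (simp add: algebra_simps)
    then show ?thesis using D'(2) by auto
  qed
  ultimately show ?thesis by simp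
qed

end

section \<open>Cuts that violate super-connectedness\<close>

lemma (in graph) not_super_connected_obtains_separation:
  assumes "\<not> super_connected G"
  obtains A B S where "separated_graph G A B S"
proof -
  obtain S where cut: "minimum_vertex_cut G S"
    and scc: "\<And>v. {v} \<in> pre_digraph.sccs_verts (remove_verts G S) \<Longrightarrow>
      out_degree G v \<noteq> min_degree G"
    using assms by (auto simp: super_connected_def)
  let ?H = "remove_verts G S"
  interpret H: sym_digraph ?H
    unfolding remove_verts_def by (rule sym_digraph_induce_subgraph)
  have VH: "verts ?H = verts G - S" by (simp add: remove_verts_def)
  have S: "S \<subseteq> verts G" "S \<noteq> verts G" "\<not> connected ?H"
    using cut by (auto simp: minimum_vertex_cut_def vertex_cut_def)
  have "verts ?H \<noteq> {}" using S VH by auto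
  from H.not_connected_imp_separation[OF S(3) this, unfolded VH]
  obtain A B where AB: "A \<union> B = verts G - S" "A \<inter> B = {}" "A \<noteq> {}" "B \<noteq> {}"
    and sep: "\<forall>a\<in>A. \<forall>b\<in>B. \<not> a \<rightarrow>\<^bsub>?H\<^esub> b"
    by auto
  have no_arc: "\<not> a \<rightarrow> b" if "a \<in> A" "b \<in> B" for a b
    using sep that AB(1) by (auto simp: remove_verts_def arcs_ends_induce_subgraph)
  obtain a b where ab: "a \<in> A" "b \<in> B" using AB by blast
  have card_S: "card S \<le> min_degree G"
    by (rule minimum_vertex_cut_card_le[OF cut, of a b]) (use ab AB no_arc in auto)
  \<comment> \<open>As |S| \<le> \<delta>, a vertex with all neighbours in \<open>S\<close> would
    have degree exactly \<delta> and form a singleton component, which the choice of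
    \<open>S\<close> forbids.\<close>
  have nonisolated: "\<exists>w\<in>verts G - S. x \<rightarrow> w" if x: "x \<in> verts G - S" for x
  proof (rule ccontr)
    assume *: "\<not> ?thesis"
    then have "{w. x \<rightarrow> w} \<subseteq> S" using adj_in_verts(2) by auto
    then have "out_degree G x \<le> card S"
      unfolding out_degree_eq_card using S(1) by (intro card_mono finite_subset[OF S(1)]) auto
    then have "out_degree G x = min_degree G" using card_S min_degree_le[of x] x by simp
    moreover have "{x} \<in> H.sccs_verts"
      by (rule H.isolated_in_sccs_verts)
        (use x * in \<open>auto simp: remove_verts_def arcs_ends_induce_subgraph\<close>)
    ultimately show False using scc by blast
  qed
  \<comment> \<open>A neighbour outside \<open>S\<close> lies in the same part, since no arc joins
    \<open>A\<close> to \<open>B\<close>.\<close>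
  have two: "2 \<le> card X" if X: "X = A \<or> X = B" for X
  proof -
    have "finite X" using X AB(1) by (metis finite_Diff finite_Un finite_verts)
    obtain x where x: "x \<in> X" using X ab by blast
    then obtain w where w: "w \<in> verts G - S" "x \<rightarrow> w" using nonisolated X AB(1) by blast
    then have "w \<in> X" using X x AB(1) no_arc graph_symmetric by blast
    moreover have "w \<noteq> x" using w(2) adj_not_same by blast
    ultimately have "card {x, w} \<le> card X" using x \<open>finite X\<close> by (intro card_mono) auto
    then show ?thesis using \<open>w \<noteq> x\<close> by simp
  qed
  have "separated_graph G A B S"
    by unfold_locales (use AB S(1) no_arc two card_S in auto)
  then show ?thesis by (rule that)
qed

section \<open>Comparison of the spectral and counting bounds\<close>

theorem theorem4p2:
  fixes G :: "('a, 'b) pre_digraph" and n \<delta> :: nat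
  assumes "graph G"
    and "connected G"
    and "card (verts G) = n"
    and "n \<ge> 5"
    and "min_degree G = \<delta>"
    and "graph_spectral_radius G \<ge>
      (real \<delta> - 1) / 2 +
      sqrt (2 + (real n - real \<delta> - 1) * (real n - 4) + (real \<delta> + 1)\<^sup>2 / 4)"
  shows "super_connected G"
proof (rule ccontr)
  interpret graph G by fact
  assume "\<not> super_connected G"
  then obtain A B S where "separated_graph G A B S"
    by (rule not_super_connected_obtains_separation)
  then interpret separated_graph G A B S .
  obtain D where D: "n = \<delta> + D + 1" using parametrize assms(3,5) by metis
  define \<rho> where "\<rho> = graph_spectral_radius G"
  define N where "N = card nonadjacent_pairs"
  define K where "K = (\<Sum>u\<in>verts G. real (out_degree G u)) - (real (card (verts G)) - 1) * \<delta>"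
  define Q where "Q = 2 + (real n - real \<delta> - 1) * (real n - 4) + (real \<delta> + 1)\<^sup>2 / 4"
  \<comment> \<open>Serves twice: it yields \<rho> \<ge> \<delta> \<ge> 0, and \<open>Q\<close>
    \<ge> 0, so that the hypothesis can be squared.\<close>
  have Q: "((real \<delta> + 1) / 2)\<^sup>2 \<le> Q"
    using assms(4) D by (simp add: Q_def power_divide)
  then have "(real \<delta> + 1) / 2 \<le> sqrt Q" by (rule real_le_rsqrt)
  moreover have \<rho>: "sqrt Q \<le> \<rho> - (real \<delta> - 1) / 2"
    using assms(6) by (simp add: \<rho>_def Q_def)
  ultimately have "\<rho> \<ge> 0" by (simp add: field_simps)
  have "Q \<ge> 0" using Q by (rule order_trans[rotated]) simp
  then have "Q \<le> (\<rho> - (real \<delta> - 1) / 2)\<^sup>2"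
    using power_mono[OF \<rho>, of 2] by simp
  \<comment> \<open>The summand \<delta> is the difference of the squares of (\<delta> + 1)/2 and
    (\<delta> - 1)/2.\<close>
  then have lower: "2 + D * (real n - 4) + \<delta> \<le> \<rho>\<^sup>2 - (real \<delta> - 1) * \<rho>"
    unfolding Q_def D by (simp add: power2_eq_square field_simps)
  \<comment> \<open>Here K + N = (n - 1)(D + 1) = D n + \<delta>; the constants 2 and n - 4 of the
    hypothesis produce the threshold 4D - 2 for \<open>N\<close>.\<close>
  have K: "2 + D * (real n - 4) + \<delta> = K + N - (4 * real D - 2)"
    unfolding K_def N_def real_card_nonadjacent_pairs assms(3) D
    by (simp add: algebra_simps)
  have N: "4 * D \<le> N + 2"
    unfolding N_def by (rule card_nonadjacent_pairs_lower_bound) (simp add: assms(3,5) D)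
  have "verts G \<noteq> {}" using assms(3,4) by auto
  then obtain f where f: "\<exists>u\<in>verts G. f u \<noteq> 0"
    "\<And>u. u \<in> verts G \<Longrightarrow> (\<Sum>w\<in>verts G. of_bool (u \<rightarrow>\<^bsub>G\<^esub> w) * f w) = \<rho> * f u"
    unfolding \<rho>_def by (rule spectral_radius_eigenfunction) blast
  note bound = eigenvalue_bound[OF assms(2) f \<open>\<rho> \<ge> 0\<close> min_degree_le, unfolded assms(5), folded K_def]
  have upper: "\<rho>\<^sup>2 - (real \<delta> - 1) * \<rho> \<le> K" by (rule bound(1))
  have "4 * real D \<le> real N + 2" using N by linarith
  \<comment> \<open>\<open>lower\<close> and \<open>upper\<close> force N \<le> 4D - 2, so both the
    counting bound and the spectral bound are tight.\<close>
  with lower upper K have "\<rho>\<^sup>2 - (real \<delta> - 1) * \<rho> = K" and eq: "real N + 2 = 4 * real D"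
    by linarith+
  note regular = bound(2)[OF _ _ this(1)]
  obtain a b where ab: "a \<in> A" "b \<in> B" using two_le by fastforce
  \<comment> \<open>Each vertex of a part has a non-neighbour in the other part, so tightness of the
    spectral bound fixes its degree.\<close>
  have "out_degree G x = min_degree G" if "x \<in> A \<union> B" for x
  proof (cases "x \<in> A")
    case True
    then show ?thesis
      using regular[of b x] ab no_arc' cover disjoint assms(5) by auto
  next
    case False
    then show ?thesis
      using regular[of a x] that ab no_arc cover disjoint assms(5) by auto
  qed
  then have "4 * D < N + 2"
    unfolding N_def by (intro card_nonadjacent_pairs_gt) (simp_all add: assms(3,5) D)
  then show False using eq by linarith
qed

end
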